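(* Let $a\in\mathbb R$, $a\neq0$. The weight matrix $$W(x)=e^{-x^2}\begin{pmatrix}1+a^2x^4&ax^2\\ ax^2&1\end{pmatrix},\qquad x\in\mathbb R,$$ is a strong Darboux transformation of the direct sum of classical scalar Hermite weights $\widetilde W(x)=e^{-x^2}I$ (of size $2\times2$, on $\mathbb R$).
   Context: For a weight matrix $W$ of size $N$ on an interval $(x_0,x_1)$ put $\langle P,Q\rangle_W=\int_{x_0}^{x_1}P(x)W(x)Q(x)^*\,dx$ for $P,Q\in\operatorname{Mat}_N(\mathbb C[x])$. The monic orthogonal polynomials of $W$ are the unique $P_n\in\operatorname{Mat}_N(\mathbb C[x])$, $n\ge0$, of degree $n$ with leading coefficient $I$ and $\langle P_n,P_m\rangle_W=0$ for $n\ne m$. Differential operators $D=\sum_{i=0}^s\partial^iF_i(x)$, $\partial=d/dx$, act on the right on matrix functions: $P\cdot D=\sum_i P^{(i)}F_i$, and products satisfy $P\cdot(D_1D_2)=(P\cdot D_1)\cdot D_2$. $\operatorname{Mat}_N(\Omega[x])$ is the algebra of such operators with coefficients $F_i\in\operatorname{Mat}_N(\mathbb C[x])$. $$\mathcal D(W)=\{D\in\operatorname{Mat}_N(\Omega[x]): P_n\cdot D=\Lambda_n(D)P_n\text{ for some }\Lambda_n(D)\in\operatorname{Mat}_N(\mathbb C),\ \forall n\ge0\}.$$ The formal adjoint ${}^*$ is the involution (reversing products) extending the Hermitian conjugate on matrix functions and sending $\partial I$ to $-\partial I$. An operator $\mathcal V\in\operatorname{Mat}_N(\Omega[x])$ is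 degree-preserving if $\deg(P\cdot\mathcal V)=\deg P$ for all $P\in\operatorname{Mat}_N(\mathbb C[x])$. Strong Darboux transformation (general definition): for weight matrices $W_1,W_2$ of size $N$ on the same interval, $W_2$ is a strong Darboux transformation of $W_1$ if there is a degree-preserving differential operator $\mathcal V\in\operatorname{Mat}_N(\Omega[x])$ with nonsingular leading coefficient (i.e. the coefficient of its highest power of $\partial$ is a matrix polynomial whose determinant is not identically zero) such that $D=\mathcal V\mathcal N\in\mathcal D(W_1)$, where $\mathcal N=W_2\mathcal V^*W_1^{-1}$ (so $Q\cdot\mathcal N=\sum_j(-1)^j(QW_2F_j^* )^{(j)}W_1^{-1}$ if $\mathcal V=\sum_j\partial^jF_j$) is a differential operator satisfying $\langle P\cdot\mathcal V,Q\rangle_{W_2}=\langle P,Q\cdot\mathcal N\rangle_{W_1}$ for all $P,Q\in\operatorname{Mat}_N(\mathbb C[x])$. *)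

theory Defs
  imports "HOL-Analysis.Analysis" "HOL-Computational_Algebra.Polynomial"
begin

section \<open>Matrix polynomials and matrix functions\<close>

type_synonym 'n mpoly = "complex poly ^ 'n ^ 'n"
type_synonym 'n mfun = "real \<Rightarrow> complex ^ 'n ^ 'n"

definition herm :: "complex ^ ('n::finite) ^ 'n \<Rightarrow> complex ^ 'n ^ 'n" where
  "herm A = (\<chi> i j. cnj (A $ j $ i))"

definition mp_eval :: "('n::finite) mpoly \<Rightarrow> 'n mfun" where
  "mp_eval P x = (\<chi> i j. poly (P $ i $ j) (complex_of_real x))"

definition mp_coeff :: "('n::finite) mpoly \<Rightarrow> nat \<Rightarrow> complex ^ 'n ^ 'n" where
  "mp_coeff P k = (\<chi> i j. coeff (P $ i $ j) k)"

(* As for the library's degree, the zero matrix polynomial gets degree 0. *)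
definition mp_degree :: "('n::finite) mpoly \<Rightarrow> nat" where
  "mp_degree P = Max (range (\<lambda>(i, j). degree (P $ i $ j)))"

definition mp_const :: "complex ^ ('n::finite) ^ 'n \<Rightarrow> 'n mpoly" where
  "mp_const A = (\<chi> i j. [:A $ i $ j:])"

definition mp_deriv :: "('n::finite) mpoly \<Rightarrow> 'n mpoly" where
  "mp_deriv P = (\<chi> i j. pderiv (P $ i $ j))"

definition mfun_deriv :: "('n::finite) mfun \<Rightarrow> 'n mfun" where
  "mfun_deriv f = (\<lambda>x. vector_derivative f (at x))"

(* Intended for open S. *)
definition mfun_times_differentiable_on :: "nat \<Rightarrow> ('n::finite) mfun \<Rightarrow> real set \<Rightarrow> bool" where
  "mfun_times_differentiable_on k f S \<longleftrightarrow>
     (\<forall>i<k. \<forall>x\<in>S. ((mfun_deriv ^^ i) f) differentiable (at x))"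

definition mfun_smooth_on :: "('n::finite) mfun \<Rightarrow> real set \<Rightarrow> bool" where
  "mfun_smooth_on f S \<longleftrightarrow> (\<forall>k. mfun_times_differentiable_on k f S)"

section \<open>Weight matrices and orthogonal polynomials\<close>

definition pos_def :: "complex ^ 'n ^ ('n::finite) \<Rightarrow> bool" where
  "pos_def A \<longleftrightarrow> herm A = A \<and>
     (\<forall>v. v \<noteq> 0 \<longrightarrow> Re (\<Sum>i\<in>UNIV. \<Sum>j\<in>UNIV. cnj (v $ i) * A $ i $ j * v $ j) > 0)"

(* Matrix function on the (possibly unbounded) interval (x0,x1), positive definite almost
   everywhere, with finite moments of all orders. *)
definition weight_matrix :: "ereal \<Rightarrow> ereal \<Rightarrow> ('n::finite) mfun \<Rightarrow> bool" where
  "weight_matrix x0 x1 W \<longleftrightarrow> x0 < x1 \<and>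
     (AE x in lborel. x \<in> einterval x0 x1 \<longrightarrow> pos_def (W x)) \<and>
     (\<forall>k::nat. interval_lebesgue_integrable lborel x0 x1 (\<lambda>x. x ^ k *\<^sub>R W x))"

definition mfun_ip :: "ereal \<Rightarrow> ereal \<Rightarrow> ('n::finite) mfun \<Rightarrow> 'n mfun \<Rightarrow> 'n mfun \<Rightarrow> complex ^ 'n ^ 'n" where
  "mfun_ip x0 x1 W f g = (LBINT x=x0..x1. f x ** W x ** herm (g x))"

definition monic_orthogonal_polys ::
  "ereal \<Rightarrow> ereal \<Rightarrow> ('n::finite) mfun \<Rightarrow> (nat \<Rightarrow> 'n mpoly) \<Rightarrow> bool" where
  "monic_orthogonal_polys x0 x1 W P \<longleftrightarrow>
     (\<forall>n. mp_degree (P n) = n \<and> mp_coeff (P n) n = mat 1) \<and>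
     (\<forall>n m. n \<noteq> m \<longrightarrow> mfun_ip x0 x1 W (mp_eval (P n)) (mp_eval (P m)) = 0)"

section \<open>Differential operators acting on the right\<close>

(* The operator with coefficients F_i (i = 0..s) placed to the right of the i-th power of the
   derivation is encoded as the (library) polynomial in that derivation with i-th coefficient F_i.
   Only the additive structure and the notions coeff, degree (= order of the operator) and
   lead_coeff of the library are meaningful: products of operators are compositions of the
   right actions. *)
type_synonym 'n mdop = "'n mpoly poly"

definition mp_act :: "('n::finite) mpoly \<Rightarrow> 'n mdop \<Rightarrow> 'n mpoly" where
  "mp_act P D = (\<Sum>i\<le>degree D. (mp_deriv ^^ i) P ** coeff D i)"

(* Right action on matrix functions of the operator with arbitrary coefficient functions
   G ! 0, G ! 1, ... *)
definition mfun_act :: "('n::finite) mfun \<Rightarrow> 'n mfun list \<Rightarrow> 'n mfun" where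
  "mfun_act f G = (\<lambda>x. \<Sum>k<length G. (mfun_deriv ^^ k) f x ** (G ! k) x)"

definition mdop_funs :: "('n::finite) mdop \<Rightarrow> 'n mfun list" where
  "mdop_funs D = map mp_eval (coeffs D)"

(* Reversing products, taking Hermitian conjugates and changing the sign of the derivation sends
   the j-th term of V to multiplication by the conjugate of its coefficient followed by (-1)^j
   times the j-th derivative. *)
definition mfun_act_adjoint :: "('n::finite) mfun \<Rightarrow> 'n mdop \<Rightarrow> 'n mfun" where
  "mfun_act_adjoint f V =
     (\<lambda>x. \<Sum>j\<le>degree V. (- 1) ^ j *\<^sub>R
        (mfun_deriv ^^ j) (\<lambda>y. f y ** herm (mp_eval (coeff V j) y)) x)"

(* The conjunct on zero is needed because mp_degree 0 = 0, whereas mathematically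
   the degree of 0 is minus infinity. *)
definition degree_preserving :: "('n::finite) mdop \<Rightarrow> bool" where
  "degree_preserving V \<longleftrightarrow>
     (\<forall>P. (mp_act P V = 0 \<longleftrightarrow> P = 0) \<and> mp_degree (mp_act P V) = mp_degree P)"

(* The algebra D(W); for a weight matrix W the sequence P is unique. *)
definition bispectral_algebra :: "ereal \<Rightarrow> ereal \<Rightarrow> ('n::finite) mfun \<Rightarrow> 'n mdop set" where
  "bispectral_algebra x0 x1 W =
     {D. \<exists>P. monic_orthogonal_polys x0 x1 W P \<and>
           (\<forall>n. \<exists>\<Lambda>. mp_act (P n) D = mp_const \<Lambda> ** P n)}"

section \<open>Strong Darboux transformations\<close>

(* N (given by smooth coefficient functions) is the differential operator W2 V* W1^{-1}.  The
   differentiability conjunct guarantees that the derivatives in mfun_act_adjoint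
   exist. *)
definition is_darboux_adjoint ::
  "ereal \<Rightarrow> ereal \<Rightarrow> ('n::finite) mfun \<Rightarrow> 'n mfun \<Rightarrow> 'n mdop \<Rightarrow> 'n mfun list \<Rightarrow> bool" where
  "is_darboux_adjoint x0 x1 W1 W2 V N \<longleftrightarrow>
     (\<forall>G\<in>set N. mfun_smooth_on G (einterval x0 x1)) \<and>
     (\<forall>f. mfun_smooth_on f (einterval x0 x1) \<longrightarrow>
        (\<forall>j\<le>degree V. mfun_times_differentiable_on j
            (\<lambda>y. f y ** W2 y ** herm (mp_eval (coeff V j) y)) (einterval x0 x1)) \<and>
        (AE x in lborel. x \<in> einterval x0 x1 \<longrightarrow>
            mfun_act f N x =
              mfun_act_adjoint (\<lambda>y. f y ** W2 y) V x ** matrix_inv (W1 x)))"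

(* D = V N as differential operators on (x0,x1), i.e. f.D = (f.V).N for all smooth f. *)
definition is_dop_product ::
  "ereal \<Rightarrow> ereal \<Rightarrow> ('n::finite) mfun list \<Rightarrow> 'n mfun list \<Rightarrow> 'n mfun list \<Rightarrow> bool" where
  "is_dop_product x0 x1 D V N \<longleftrightarrow>
     (\<forall>f. mfun_smooth_on f (einterval x0 x1) \<longrightarrow>
        (\<forall>x\<in>einterval x0 x1. mfun_act f D x = mfun_act (mfun_act f V) N x))"

definition strong_darboux_transformation ::
  "ereal \<Rightarrow> ereal \<Rightarrow> ('n::finite) mfun \<Rightarrow> 'n mfun \<Rightarrow> bool" where
  \<comment> \<open>W2 is a strong Darboux transformation of W1\<close>
  "strong_darboux_transformation x0 x1 W1 W2 \<longleftrightarrow>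
     weight_matrix x0 x1 W1 \<and> weight_matrix x0 x1 W2 \<and>
     (\<exists>(V :: 'n mdop) N D.
        degree_preserving V \<and> det (lead_coeff V) \<noteq> 0 \<and>
        is_darboux_adjoint x0 x1 W1 W2 V N \<and>
        is_dop_product x0 x1 (mdop_funs D) (mdop_funs V) N \<and>
        D \<in> bispectral_algebra x0 x1 W1 \<and>
        (\<forall>P Q. mfun_ip x0 x1 W2 (mp_eval (mp_act P V)) (mp_eval Q) =
               mfun_ip x0 x1 W1 (mp_eval P) (mfun_act (mp_eval Q) N)))"

definition hermite_weight :: "2 mfun" where
  "hermite_weight x = exp (- x\<^sup>2) *\<^sub>R mat 1"

definition example_weight :: "real \<Rightarrow> 2 mfun" where
  "example_weight a x = exp (- x\<^sup>2) *\<^sub>R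
     vector [vector [complex_of_real (1 + a\<^sup>2 * x ^ 4), complex_of_real (a * x\<^sup>2)],
             vector [complex_of_real (a * x\<^sup>2), 1]]"

end

theory Submission
  imports Defs "HOL-Probability.Distributions"
begin

text \<open>
  The weight factors as \<open>W = e\<^sup>-\<^sup>x\<^sup>2 T T\<^sup>*\<close> with \<open>T = (1, a x\<^sup>2; 0, 1)\<close>. Let \<open>R = 2x - \<partial>\<close> be the adjoint of
  \<open>\<partial>\<close> for the Hermite weight, so that \<open>R\<close> raises and \<open>\<partial>\<close> lowers the index of the Hermite polynomials.
  Put \<open>U = (1, (a/4) R\<^sup>2; -(a/4) \<partial>\<^sup>2, 1)\<close>, \<open>V = U T\<^sup>-\<^sup>1\<close> and \<open>N = T U\<^sup>\<dagger>\<close>. In the second column of \<open>V\<close> the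
  terms raising the degree cancel: on the coefficients of degree \<open>n\<close>, \<open>V\<close> acts by the triangular matrix with
  diagonal \<open>1, 1 + a\<^sup>2 n (n - 1) / 4\<close>, so it preserves degrees. The off-diagonal entries of \<open>D = V N = U U\<^sup>\<dagger>\<close>
  cancel, and \<open>D = diag (1 + (a/4)\<^sup>2 R\<^sup>2 \<partial>\<^sup>2, 1 + (a/4)\<^sup>2 \<partial>\<^sup>2 R\<^sup>2)\<close> (operators acting on the right) is
  diagonalized by the Hermite polynomials.
\<close>

section \<open>Matrix functions and matrix polynomials\<close>

text \<open>Bilinear maps between finite-dimensional spaces are bounded. This yields both the
  Leibniz rule for matrix functions and the distributive laws, including those for real
  scaling.\<close>

lemma bounded_bilinear_matrix_mult:
  "bounded_bilinear ((**) :: complex^('n::finite)^('m::finite) \<Rightarrow> complex^('p::finite)^'n \<Rightarrow> _)"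
  unfolding bilinear_conv_bounded_bilinear[symmetric] bilinear_def
  by (auto intro!: linearI simp: vec_eq_iff matrix_matrix_mult_def algebra_simps sum.distrib scaleR_sum_right)

lemmas matrix_mult_distribs =
  bounded_bilinear.add_left[OF bounded_bilinear_matrix_mult]
  bounded_bilinear.add_right[OF bounded_bilinear_matrix_mult]
  bounded_bilinear.diff_left[OF bounded_bilinear_matrix_mult]
  bounded_bilinear.diff_right[OF bounded_bilinear_matrix_mult]
  bounded_bilinear.minus_left[OF bounded_bilinear_matrix_mult]
  bounded_bilinear.minus_right[OF bounded_bilinear_matrix_mult]
  bounded_bilinear.scaleR_left[OF bounded_bilinear_matrix_mult]
  bounded_bilinear.scaleR_right[OF bounded_bilinear_matrix_mult]
  bounded_bilinear.zero_left[OF bounded_bilinear_matrix_mult]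
  bounded_bilinear.zero_right[OF bounded_bilinear_matrix_mult]

lemma has_vector_derivative_matrix_mult:
  fixes f :: "real \<Rightarrow> complex^('n::finite)^('m::finite)" and g :: "real \<Rightarrow> complex^('p::finite)^'n"
  assumes "(f has_vector_derivative f') (at x)" "(g has_vector_derivative g') (at x)"
  shows "((\<lambda>x. f x ** g x) has_vector_derivative f' ** g x + f x ** g') (at x)"
  using bounded_bilinear.has_vector_derivative[OF bounded_bilinear_matrix_mult assms]
  by (simp add: add.commute)

lemma has_vector_derivative_vec:
  fixes f :: "real \<Rightarrow> 'a::real_normed_vector^'n::finite"
  assumes "\<And>i. ((\<lambda>x. f x $ i) has_vector_derivative f' $ i) (at x)"
  shows "(f has_vector_derivative f') (at x)"
  using assms unfolding has_vector_derivative_def has_derivative_at_within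
  by (auto intro!: vec_tendstoI bounded_linear_scaleR_left)

lemma mfun_derivI:
  "(\<And>x. (f has_vector_derivative f' x) (at x)) \<Longrightarrow> mfun_deriv f = f'"
  by (auto simp: mfun_deriv_def vector_derivative_at)

lemma mp_eval_nth: "mp_eval P x $ i $ j = poly (P $ i $ j) (complex_of_real x)"
  by (simp add: mp_eval_def)

lemma mp_deriv_nth: "mp_deriv P $ i $ j = pderiv (P $ i $ j)"
  by (simp add: mp_deriv_def)

lemma matrix_mult_nth: "(A ** B) $ i $ j = (\<Sum>k\<in>UNIV. A $ i $ k * B $ k $ j)"
  by (simp add: matrix_matrix_mult_def)

lemma mp_eval_add: "mp_eval (P + Q) x = mp_eval P x + mp_eval Q x"
  by (simp add: vec_eq_iff mp_eval_nth)

lemma mp_eval_diff: "mp_eval (P - Q) x = mp_eval P x - mp_eval Q x"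
  by (simp add: vec_eq_iff mp_eval_nth)

lemma mp_eval_zero: "mp_eval 0 x = 0"
  by (simp add: vec_eq_iff mp_eval_nth)

lemma mp_eval_mult: "mp_eval (P ** Q) x = mp_eval P x ** mp_eval Q x"
  by (simp add: vec_eq_iff mp_eval_nth matrix_mult_nth poly_sum)

lemma has_vector_derivative_poly_of_real:
  "((\<lambda>x. poly p (complex_of_real x)) has_vector_derivative poly (pderiv p) (of_real x)) (at x)"
proof -
  have "(complex_of_real has_vector_derivative 1) (at x)"
    using bounded_linear.has_vector_derivative[OF bounded_linear_of_real has_vector_derivative_id] by simp
  from field_vector_diff_chain_at[OF this poly_DERIV] show ?thesis
    by (simp add: o_def)
qed

lemma has_vector_derivative_mp_eval:
  "(mp_eval P has_vector_derivative mp_eval (mp_deriv P) x) (at x)"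
  by (intro has_vector_derivative_vec)
     (simp add: mp_eval_nth mp_deriv_nth has_vector_derivative_poly_of_real)

lemma mfun_deriv_mp_eval: "mfun_deriv (mp_eval P) = mp_eval (mp_deriv P)"
  by (intro mfun_derivI has_vector_derivative_mp_eval)

section \<open>Smoothness\<close>

lemma times_differentiable_0: "mfun_times_differentiable_on 0 f UNIV"
  by (simp add: mfun_times_differentiable_on_def)

text \<open>The innermost derivative is split off, so inductions on \<open>k\<close> can pass from
  \<open>f\<close> to \<open>mfun_deriv f\<close>.\<close>

lemma times_differentiable_Suc:
  "mfun_times_differentiable_on (Suc k) f UNIV \<longleftrightarrow>
     (\<forall>x. f differentiable (at x)) \<and> mfun_times_differentiable_on k (mfun_deriv f) UNIV"
  unfolding mfun_times_differentiable_on_def All_less_Suc2 funpow_Suc_right by simp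

lemma times_differentiable_SucI:
  assumes "\<And>x. (f has_vector_derivative f' x) (at x)" "mfun_times_differentiable_on k f' UNIV"
  shows "mfun_times_differentiable_on (Suc k) f UNIV"
  using assms mfun_derivI[OF assms(1)]
  by (auto simp: times_differentiable_Suc intro: differentiableI_vector)

lemma times_differentiable_SucD:
  "mfun_times_differentiable_on (Suc k) f UNIV \<Longrightarrow> (f has_vector_derivative mfun_deriv f x) (at x)"
  by (auto simp: times_differentiable_Suc mfun_deriv_def vector_derivative_works)

lemma times_differentiable_mono:
  "mfun_times_differentiable_on k f S \<Longrightarrow> j \<le> k \<Longrightarrow> mfun_times_differentiable_on j f S"
  by (auto simp: mfun_times_differentiable_on_def)

lemma times_differentiable_add:
  "mfun_times_differentiable_on k f UNIV \<Longrightarrow> mfun_times_differentiable_on k g UNIV \<Longrightarrow>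
   mfun_times_differentiable_on k (\<lambda>x. f x + g x) UNIV"
proof (induction k arbitrary: f g)
  case (Suc k)
  note der = Suc.prems[THEN times_differentiable_SucD]
  from Suc have "mfun_times_differentiable_on k (\<lambda>x. mfun_deriv f x + mfun_deriv g x) UNIV"
    by (simp add: times_differentiable_Suc)
  then show ?case
    by (rule times_differentiable_SucI[OF has_vector_derivative_add[OF der]])
qed (rule times_differentiable_0)

lemma times_differentiable_mult:
  "mfun_times_differentiable_on k f UNIV \<Longrightarrow> mfun_times_differentiable_on k g UNIV \<Longrightarrow>
   mfun_times_differentiable_on k (\<lambda>x. f x ** g x) UNIV"
proof (induction k arbitrary: f g)
  case (Suc k)
  note der = Suc.prems[THEN times_differentiable_SucD]
  have "mfun_times_differentiable_on k f UNIV" "mfun_times_differentiable_on k g UNIV"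
    using Suc.prems times_differentiable_mono[of "Suc k" _ UNIV k] by auto
  moreover have "mfun_times_differentiable_on k (mfun_deriv f) UNIV"
      "mfun_times_differentiable_on k (mfun_deriv g) UNIV"
    using Suc.prems by (auto simp: times_differentiable_Suc)
  ultimately have "mfun_times_differentiable_on k (\<lambda>x. mfun_deriv f x ** g x + f x ** mfun_deriv g x) UNIV"
    by (intro times_differentiable_add Suc.IH)
  then show ?case
    by (rule times_differentiable_SucI[OF has_vector_derivative_matrix_mult[OF der]])
qed (rule times_differentiable_0)

lemma times_differentiable_mp_eval: "mfun_times_differentiable_on k (mp_eval P) UNIV"
proof (induction k arbitrary: P)
  case (Suc k)
  show ?case
    by (rule times_differentiable_SucI[OF has_vector_derivative_mp_eval Suc.IH])
qed (rule times_differentiable_0)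

lemma smooth_mp_eval: "mfun_smooth_on (mp_eval P) UNIV"
  by (simp add: mfun_smooth_on_def times_differentiable_mp_eval)

lemma smooth_has_vector_derivative:
  "mfun_smooth_on f UNIV \<Longrightarrow> (f has_vector_derivative mfun_deriv f x) (at x)"
  by (auto simp: mfun_smooth_on_def intro: times_differentiable_SucD)

lemma smooth_mfun_deriv: "mfun_smooth_on f UNIV \<Longrightarrow> mfun_smooth_on (mfun_deriv f) UNIV"
  unfolding mfun_smooth_on_def using times_differentiable_Suc by blast

section \<open>Operators with polynomial coefficients\<close>

lemma mp_act_0: "mp_act P 0 = 0"
  by (simp add: mp_act_def matrix_matrix_mult_def vec_eq_iff)

text \<open>\<open>pCons F D\<close> encodes F + \<partial>D, and P acted on by \<partial> is P'.
  This recursion lets operators given as coefficient lists be evaluated by rewriting.\<close>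

lemma mp_act_pCons: "mp_act P (pCons F D) = P ** F + mp_act (mp_deriv P) D"
proof (cases "D = 0")
  case False
  then show ?thesis
    unfolding mp_act_def degree_pCons_eq[OF False] sum.atMost_Suc_shift
    by (simp add: funpow_swap1 del: sum.atMost_Suc)
qed (simp add: mp_act_def matrix_matrix_mult_def vec_eq_iff)

lemma mfun_act_Nil: "mfun_act f [] x = 0"
  by (simp add: mfun_act_def)

lemma mfun_act_Cons: "mfun_act f (G # Gs) x = f x ** G x + mfun_act (mfun_deriv f) Gs x"
  unfolding mfun_act_def length_Cons sum.lessThan_Suc_shift
  by (simp add: funpow_swap1)

lemma mfun_act_mdop_funs_0: "mfun_act f (mdop_funs 0) x = 0"
  by (simp add: mdop_funs_def mfun_act_Nil)

lemma mfun_act_mdop_funs_pCons: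
  "mfun_act f (mdop_funs (pCons F D)) x = f x ** mp_eval F x + mfun_act (mfun_deriv f) (mdop_funs D) x"
  \<comment> \<open>\<open>coeffs\<close> of the zero operator is the empty list, hence the separate
    case.\<close>
  by (cases "F = 0 \<and> D = 0")
     (auto simp: mdop_funs_def mfun_act_Nil mfun_act_Cons cCons_def mp_eval_zero matrix_mult_distribs)

lemma mfun_act_mp_eval: "mfun_act (mp_eval P) (mdop_funs D) x = mp_eval (mp_act P D) x"
  by (induction D arbitrary: P)
     (auto simp: mfun_act_mdop_funs_0 mp_act_0 mp_eval_zero mfun_act_mdop_funs_pCons mp_act_pCons
        mfun_deriv_mp_eval mp_eval_add mp_eval_mult)

section \<open>Gaussian integrals of polynomials\<close>

text \<open>For even \<open>k\<close> this is Gamma((k + 1)/2).\<close>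

definition gauss_moment :: "nat \<Rightarrow> real" where
  "gauss_moment k = (if even k then sqrt pi * (fact k / (2 ^ k * fact (k div 2))) else 0)"

lemma has_bochner_integral_gauss_moment:
  "has_bochner_integral lborel (\<lambda>x. exp (- x\<^sup>2) * x ^ k) (gauss_moment k)"
proof (cases "even k")
  case True
  then obtain m where k: "k = 2 * m" by auto
  show ?thesis
    using has_bochner_integral_even_function[OF gaussian_moment_even_pos[where k = m]]
    by (simp add: k gauss_moment_def)
next
  case False
  then obtain m where k: "k = 2 * m + 1" using oddE by blast
  show ?thesis
    using has_bochner_integral_odd_function[OF gaussian_moment_odd_pos[where k = m]]
    by (simp add: k gauss_moment_def)
qed

lemma gauss_moment_Suc_Suc: "2 * gauss_moment (Suc (Suc k)) = (real k + 1) * gauss_moment k"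
proof (cases "even k")
  case True
  then obtain m where k: "k = 2 * m" by auto
  have *: "2 * (1 + real m) * x / (4 * (2 ^ (2 * m) * ((1 + real m) * fact m))) * 2
         = x / (2 ^ (2 * m) * fact m)" for x
    by (simp add: divide_simps)
  have "Suc (Suc (2 * m)) div 2 = Suc m" by simp
  then show ?thesis
    using *[of "sqrt pi * ((1 + 2 * real m) * fact (2 * m))"]
    by (simp add: k gauss_moment_def algebra_simps)
qed (simp add: gauss_moment_def)

definition gauss_int :: "complex poly \<Rightarrow> complex" where
  "gauss_int p = (\<integral>x. exp (- x\<^sup>2) *\<^sub>R poly p (complex_of_real x) \<partial>lborel)"

lemma has_bochner_integral_gauss_poly:
  "has_bochner_integral lborel (\<lambda>x. exp (- x\<^sup>2) *\<^sub>R poly p (complex_of_real x))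
     (\<Sum>k\<le>degree p. coeff p k * complex_of_real (gauss_moment k))"
proof -
  have "has_bochner_integral lborel
      (\<lambda>x. \<Sum>k\<le>degree p. coeff p k * complex_of_real (exp (- x\<^sup>2) * x ^ k))
      (\<Sum>k\<le>degree p. coeff p k * complex_of_real (gauss_moment k))"
    by (intro has_bochner_integral_sum has_bochner_integral_mult_right has_bochner_integral_of_real
        has_bochner_integral_gauss_moment)
  also have "(\<lambda>x. \<Sum>k\<le>degree p. coeff p k * complex_of_real (exp (- x\<^sup>2) * x ^ k))
      = (\<lambda>x. exp (- x\<^sup>2) *\<^sub>R poly p (complex_of_real x))"
    by (simp add: fun_eq_iff poly_altdef scaleR_conv_of_real sum_distrib_left mult_ac)
  finally show ?thesis .
qed

lemmas integrable_gauss_poly = integrable.intros[OF has_bochner_integral_gauss_poly]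

lemma gauss_int_add: "gauss_int (p + q) = gauss_int p + gauss_int q"
  by (simp add: gauss_int_def scaleR_add_right integrable_gauss_poly)

lemma gauss_int_diff: "gauss_int (p - q) = gauss_int p - gauss_int q"
  by (simp add: gauss_int_def scaleR_diff_right integrable_gauss_poly)

lemma gauss_int_smult: "gauss_int (smult c p) = c * gauss_int p"
  by (simp add: gauss_int_def flip: integral_mult_right_zero)

lemma gauss_int_0: "gauss_int 0 = 0"
  by (simp add: gauss_int_def)

lemma gauss_int_sum: "gauss_int (sum p A) = (\<Sum>i\<in>A. gauss_int (p i))"
  by (induction A rule: infinite_finite_induct) (simp_all add: gauss_int_0 gauss_int_add)

lemma gauss_int_monom: "gauss_int (monom c k) = c * complex_of_real (gauss_moment k)"
proof -
  have "(\<Sum>i\<le>degree (monom c k). coeff (monom c k) i * complex_of_real (gauss_moment i))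
      = c * complex_of_real (gauss_moment k)"
    by (cases "c = 0") (simp_all add: degree_monom_eq if_distrib if_distribR sum.delta cong: if_cong)
  then show ?thesis
    using has_bochner_integral_integral_eq[OF has_bochner_integral_gauss_poly[of "monom c k"]]
    by (simp add: gauss_int_def)
qed

text \<open>Integration by parts against e^(-x^2). By linearity it reduces to monomials, where it is
  the recursion \<open>gauss_moment_Suc_Suc\<close>, so no boundary terms have to be
  estimated.\<close>

lemma gauss_int_pderiv: "gauss_int (pderiv p) = gauss_int ([:0, 2:] * p)"
proof -
  have mon: "gauss_int (pderiv (monom c k)) = gauss_int ([:0, 2:] * monom c k)" for c k
  proof -
    have x: "[:0, 2:] * monom c k = monom (2 * c) (Suc k)"
      by (simp add: monom_Suc smult_monom)
    show ?thesis
    proof (cases k)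
      case 0
      then show ?thesis
        unfolding x pderiv_monom by (simp add: gauss_int_monom gauss_int_0 gauss_moment_def)
    next
      case (Suc m)
      show ?thesis
        unfolding x pderiv_monom gauss_int_monom
        using arg_cong[OF gauss_moment_Suc_Suc[of m], of complex_of_real]
        by (auto simp: Suc mult_ac add_ac)
    qed
  qed
  have "gauss_int (pderiv (\<Sum>i\<le>degree p. monom (coeff p i) i))
      = gauss_int ([:0, 2:] * (\<Sum>i\<le>degree p. monom (coeff p i) i))"
    by (simp only: higher_pderiv_sum[of 1, simplified] sum_distrib_left gauss_int_sum mon)
  then show ?thesis by (simp only: poly_as_sum_of_monoms)
qed

text \<open>\<open>gauss_int_pderiv\<close> applied to the product \<open>p * q\<close>. The pairing
  is bilinear; conjugation enters only with \<open>mp_herm\<close>.\<close>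

lemma gauss_int_adjoint:
  "gauss_int (([:0, 2:] * p - pderiv p) * q) = gauss_int (p * pderiv q)"
proof -
  have "([:0, 2:] * p - pderiv p) * q = [:0, 2:] * (p * q) - pderiv (p * q) + p * pderiv q"
    by (simp only: pderiv_mult algebra_simps)
  then show ?thesis
    by (simp only: gauss_int_add gauss_int_diff gauss_int_pderiv) simp
qed

section \<open>Reduction of matrix integrals to scalar Gaussian integrals\<close>

lemma integrable_vec:
  fixes f :: "'a \<Rightarrow> 'b::euclidean_space^'n::finite"
  assumes "\<And>i. integrable M (\<lambda>x. f x $ i)"
  shows "integrable M f"
proof -
  have "bounded_linear (axis i :: 'b \<Rightarrow> 'b^'n)" for i
    unfolding linear_conv_bounded_linear[symmetric]
    by (rule linearI) (auto simp: axis_def vec_eq_iff)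
  then have "integrable M (\<lambda>x. \<Sum>i\<in>UNIV. axis i (f x $ i) :: 'b^'n)"
    by (intro Bochner_Integration.integrable_sum integrable_bounded_linear[where T = "axis _"] assms)
  also have "(\<lambda>x. \<Sum>i\<in>UNIV. axis i (f x $ i) :: 'b^'n) = f"
    by (simp add: fun_eq_iff vec_eq_iff axis_def if_distrib sum.delta cong: if_cong)
  finally show ?thesis .
qed

lemma integrable_gauss_mp_eval: "integrable lborel (\<lambda>x. exp (- x\<^sup>2) *\<^sub>R mp_eval M x)"
  by (intro integrable_vec) (simp add: mp_eval_nth integrable_gauss_poly)

lemma einterval_UNIV: "einterval (- \<infinity>) \<infinity> = UNIV"
  by (auto simp: einterval_def)

text \<open>Taking an entry is a bounded linear map, so it commutes with the integral once the whole
  matrix function is integrable. Every inner product below is computed through this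
  reduction.\<close>

lemma mfun_ip_gauss:
  assumes "\<And>x. f x ** W x ** herm (g x) = exp (- x\<^sup>2) *\<^sub>R mp_eval M x"
  shows "mfun_ip (- \<infinity>) \<infinity> W f g $ i $ j = gauss_int (M $ i $ j)"
proof -
  let ?F = "\<lambda>x. exp (- x\<^sup>2) *\<^sub>R mp_eval M x"
  have nth: "bounded_linear (\<lambda>A::complex^'a^'a. A $ i $ j)"
    by (intro bounded_linear_compose[OF bounded_linear_vec_nth bounded_linear_vec_nth])
  have "mfun_ip (- \<infinity>) \<infinity> W f g = integral\<^sup>L lborel ?F"
    by (simp add: mfun_ip_def assms interval_lebesgue_integral_def einterval_UNIV
        set_lebesgue_integral_def)
  then show ?thesis
    using integral_bounded_linear[OF nth integrable_gauss_mp_eval[of M]]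
    by (simp add: gauss_int_def mp_eval_nth)
qed

lemma weight_matrix_gauss:
  assumes W: "\<And>x. W x = exp (- x\<^sup>2) *\<^sub>R mp_eval M x" and pos: "\<And>x. pos_def (W x)"
  shows "weight_matrix (- \<infinity>) \<infinity> W"
proof -
  have "integrable lborel (\<lambda>x. x ^ k *\<^sub>R W x)" for k
  proof -
    have "mp_eval (\<chi> i j. monom 1 k * M $ i $ j) x = x ^ k *\<^sub>R mp_eval M x" for x
      by (simp add: vec_eq_iff mp_eval_nth poly_monom scaleR_conv_of_real[where 'a = complex])
    then have "x ^ k *\<^sub>R W x = exp (- x\<^sup>2) *\<^sub>R mp_eval (\<chi> i j. monom 1 k * M $ i $ j) x" for x
      by (simp only: W scaleR_left_commute)
    then show ?thesis by (simp only: integrable_gauss_mp_eval)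
  qed
  with pos show ?thesis
    by (simp only: weight_matrix_def interval_lebesgue_integrable_def einterval_UNIV
        set_integrable_def) simp
qed

text \<open>Coefficients are conjugated but the variable is not, which matches \<open>herm\<close>
  at real points.\<close>

definition mp_herm :: "('n::finite) mpoly \<Rightarrow> 'n mpoly" where
  "mp_herm P = (\<chi> i j. map_poly cnj (P $ j $ i))"

lemma mp_herm_nth: "mp_herm P $ i $ j = map_poly cnj (P $ j $ i)"
  by (simp add: mp_herm_def)

lemma herm_mp_eval: "herm (mp_eval P x) = mp_eval (mp_herm P) x"
  by (simp add: herm_def vec_eq_iff mp_eval_nth mp_herm_nth)

section \<open>Monic Hermite polynomials\<close>

text \<open>These are H_n / 2^n for the physicists' H_n. The recursion by the raising operator makes
  both orthogonality and the eigenvalues of \<open>darboux_D\<close> follow from ladder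
  relations.\<close>

fun hermite :: "nat \<Rightarrow> complex poly" where
  "hermite 0 = 1"
| "hermite (Suc n) = smult (1 / 2) ([:0, 2:] * hermite n - pderiv (hermite n))"

text \<open>Induction from the commutation rule (R p)' = 2 p + R p', where R p = 2 x p - p'.\<close>

lemma pderiv_hermite: "pderiv (hermite (Suc n)) = smult (of_nat (Suc n)) (hermite n)"
proof (induction n)
  case 0
  show ?case by (simp add: pderiv_smult pderiv_pCons one_pCons)
next
  case (Suc n)
  let ?h = "hermite (Suc n)"
  have x: "pderiv ([:0, 2:] :: complex poly) = [:2:]" by (simp add: pderiv_pCons)
  have "pderiv (hermite (Suc (Suc n)))
      = ?h + smult (1 / 2) ([:0, 2:] * pderiv ?h - pderiv (pderiv ?h))"
    unfolding hermite.simps(2)[of "Suc n"] pderiv_smult pderiv_diff pderiv_mult x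
    by (simp add: smult_add_right smult_diff_right del: hermite.simps)
  also have "smult (1 / 2) ([:0, 2:] * pderiv ?h - pderiv (pderiv ?h)) = smult (of_nat (Suc n)) ?h"
    by (simp only: Suc.IH)
      (simp only: hermite.simps(2)[of n] pderiv_smult mult_smult_left mult_smult_right smult_diff_right smult_smult mult.commute)
  finally show ?case
    by (metis add.commute of_nat_Suc smult_1_left smult_add_left)
qed

lemma coeff_hermite: "coeff (hermite n) n = 1 \<and> (\<forall>k>n. coeff (hermite n) k = 0)"
proof (induction n)
  case (Suc n)
  then show ?case
    by (auto simp: coeff_pderiv coeff_pCons split: nat.splits)
qed (auto simp: coeff_1)

lemma degree_hermite: "degree (hermite n) = n"
  using coeff_hermite[of n] by (intro antisym degree_le le_degree) auto

lemma cnj_hermite: "map_poly cnj (hermite n) = hermite n"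
proof -
  have "cnj (coeff (hermite n) k) = coeff (hermite n) k" for k
    by (induction n arbitrary: k) (auto simp: coeff_pderiv coeff_pCons split: nat.splits)
  then show ?thesis by (simp add: poly_eq_iff coeff_map_poly)
qed

text \<open>Each of the \<open>n\<close> raising factors of \<open>hermite n\<close> moves onto
  \<open>q\<close> as a derivative, and \<open>n\<close> derivatives annihilate
  \<open>q\<close>.\<close>

lemma gauss_int_hermite_lower: "degree q < n \<Longrightarrow> gauss_int (hermite n * q) = 0"
proof (induction n arbitrary: q)
  case (Suc n)
  have "gauss_int (hermite (Suc n) * q) = (1 / 2) * gauss_int (hermite n * pderiv q)"
    by (simp only: hermite.simps mult_smult_left gauss_int_smult gauss_int_adjoint)
  also have "gauss_int (hermite n * pderiv q) = 0"
  \<comment> \<open>For constant \<open>q\<close> the degree does not drop, so the induction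
    hypothesis may fail to apply; the derivative is then zero.\<close>
  proof (cases "degree q = 0")
    case True
    then have "pderiv q = 0" by (simp add: pderiv_eq_0_iff)
    then show ?thesis by (simp add: gauss_int_0)
  next
    case False
    with Suc.prems show ?thesis by (intro Suc.IH) (simp add: degree_pderiv)
  qed
  finally show ?case by simp
qed simp

lemma gauss_int_hermite: "n \<noteq> m \<Longrightarrow> gauss_int (hermite n * hermite m) = 0"
  using gauss_int_hermite_lower[of "hermite m" n] gauss_int_hermite_lower[of "hermite n" m]
  by (cases "m < n") (auto simp: degree_hermite mult.commute)

section \<open>The Darboux operators\<close>

definition mat22 :: "'a \<Rightarrow> 'a \<Rightarrow> 'a \<Rightarrow> 'a \<Rightarrow> 'a::zero^2^2" where
  "mat22 p q r s = vector [vector [p, q], vector [r, s]]"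

lemma mat22_nth [simp]:
  "mat22 p q r s $ 1 $ 1 = p" "mat22 p q r s $ 1 $ 2 = q"
  "mat22 p q r s $ 2 $ 1 = r" "mat22 p q r s $ 2 $ 2 = s"
  by (simp_all add: mat22_def vector_2)

lemma mat22_eqI:
  "A $ 1 $ 1 = B $ 1 $ 1 \<Longrightarrow> A $ 1 $ 2 = B $ 1 $ 2 \<Longrightarrow> A $ 2 $ 1 = B $ 2 $ 1 \<Longrightarrow> A $ 2 $ 2 = B $ 2 $ 2
   \<Longrightarrow> (A :: 'a^2^2) = B"
  by (simp add: vec_eq_iff forall_2)

text \<open>Comparing values turns identities between polynomials with explicit coefficients into
  ring identities that simplification can normalize.\<close>

lemma poly_eqI_complex: "(\<And>z. poly p z = poly q z) \<Longrightarrow> p = (q :: complex poly)"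
  using poly_eq_poly_eq_iff by blast

definition darboux_V :: "complex \<Rightarrow> 2 mdop" where
  "darboux_V a = [: mat22 1 [:- a / 2:] 0 1, mat22 0 [:0, - a:] 0 0,
     mat22 0 [:a / 4:] [:- a / 4:] [:0, 0, a\<^sup>2 / 4:] :]"

definition darboux_N :: "complex \<Rightarrow> 2 mdop" where
  "darboux_N a = [: mat22 [:1 + a\<^sup>2 / 2:] [:a / 2:] 0 1, mat22 [:0, a\<^sup>2:] [:0, a:] 0 0,
     mat22 [:0, 0, a\<^sup>2 / 4:] [:- a / 4:] [:a / 4:] 0 :]"

definition darboux_D :: "complex \<Rightarrow> 2 mdop" where
  "darboux_D a = [: mat22 [:1 + a\<^sup>2 / 2:] 0 0 1, mat22 [:0, a\<^sup>2:] 0 0 0,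
     mat22 [:- 5 * a\<^sup>2 / 8, 0, a\<^sup>2 / 4:] 0 0 [:- a\<^sup>2 / 8, 0, a\<^sup>2 / 4:],
     mat22 [:0, - a\<^sup>2 / 4:] 0 0 [:0, - a\<^sup>2 / 4:], mat22 [:a\<^sup>2 / 16:] 0 0 [:a\<^sup>2 / 16:] :]"

definition weight_poly :: "complex \<Rightarrow> 2 mpoly" where
  "weight_poly a = mat22 [:1, 0, 0, 0, a\<^sup>2:] [:0, 0, a:] [:0, 0, a:] 1"

text \<open>Multiplying by the inverse of T subtracts a x^2 times the first component from (a/4) R^2
  p1 + p2; the two terms a x^2 p1 cancel.\<close>

lemma mp_act_V_nth:
  "mp_act P (darboux_V a) $ i $ 1 = P $ i $ 1 - smult (a / 4) (pderiv (pderiv (P $ i $ 2)))"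
  "mp_act P (darboux_V a) $ i $ 2 =
     smult (a / 4) (pderiv (pderiv (P $ i $ 1)) - [:0, 4:] * pderiv (P $ i $ 1) - smult 2 (P $ i $ 1))
     + P $ i $ 2 + [:0, 0, a\<^sup>2 / 4:] * pderiv (pderiv (P $ i $ 2))"
  by (rule poly_eqI_complex,
      simp add: darboux_V_def mp_act_pCons mp_act_0 matrix_mult_nth sum_2 mp_deriv_nth algebra_simps)+

text \<open>With r = a x^2 p1 + p2 the components are p1 + (a/4) r'' and r - (a/4) R^2 p1.\<close>

lemma mp_act_N_nth:
  "mp_act P (darboux_N a) $ i $ 1 = P $ i $ 1 + smult (a / 4) (pderiv (pderiv (P $ i $ 2))
     + [:0, 0, a:] * pderiv (pderiv (P $ i $ 1)) + [:0, 4 * a:] * pderiv (P $ i $ 1)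
     + smult (2 * a) (P $ i $ 1))"
  "mp_act P (darboux_N a) $ i $ 2 = P $ i $ 2 -
     smult (a / 4) (pderiv (pderiv (P $ i $ 1)) - [:0, 4:] * pderiv (P $ i $ 1) - smult 2 (P $ i $ 1))"
  by (rule poly_eqI_complex,
      simp add: darboux_N_def mp_act_pCons mp_act_0 matrix_mult_nth sum_2 mp_deriv_nth
        algebra_simps power2_eq_square)+

definition hermite_raise :: "complex poly \<Rightarrow> complex poly" where
  "hermite_raise p = [:0, 2:] * p - pderiv p"

lemma hermite_raise_hermite: "hermite_raise (hermite n) = smult 2 (hermite (Suc n))"
  by (simp add: hermite_raise_def)

lemma hermite_raise_smult: "hermite_raise (smult c p) = smult c (hermite_raise p)"
  by (simp add: hermite_raise_def pderiv_smult smult_diff_right)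

lemma hermite_raise_raise:
  "hermite_raise (hermite_raise p) = pderiv (pderiv p) - [:0, 4:] * pderiv p + [:- 2, 0, 4:] * p"
  by (rule poly_eqI_complex)
     (simp add: hermite_raise_def pderiv_diff pderiv_pCons pderiv_smult algebra_simps)

lemma mp_act_D_nth:
  "mp_act P (darboux_D a) $ i $ 1 =
     P $ i $ 1 + smult (a\<^sup>2 / 16) (pderiv (pderiv (hermite_raise (hermite_raise (P $ i $ 1)))))"
  "mp_act P (darboux_D a) $ i $ 2 =
     P $ i $ 2 + smult (a\<^sup>2 / 16) (hermite_raise (hermite_raise (pderiv (pderiv (P $ i $ 2)))))"
proof -
  \<comment> \<open>Normal form with the derivatives of \<open>p\<close> separated, to be matched
    with the coefficients in \<open>darboux_D\<close>.\<close>
  have *: "pderiv (pderiv (hermite_raise (hermite_raise p))) = pderiv (pderiv (pderiv (pderiv p)))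
      - [:0, 4:] * pderiv (pderiv (pderiv p)) + [:- 10, 0, 4:] * pderiv (pderiv p)
      + [:0, 16:] * pderiv p + smult 8 p" for p
    by (rule poly_eqI_complex) (simp add: hermite_raise_raise pderiv_mult pderiv_add pderiv_diff
        pderiv_pCons pderiv_smult algebra_simps)
  show "mp_act P (darboux_D a) $ i $ 1 =
     P $ i $ 1 + smult (a\<^sup>2 / 16) (pderiv (pderiv (hermite_raise (hermite_raise (P $ i $ 1)))))"
    unfolding * by (rule poly_eqI_complex) (simp add: darboux_D_def mp_act_pCons mp_act_0 matrix_mult_nth sum_2
        mp_deriv_nth field_simps)
  show "mp_act P (darboux_D a) $ i $ 2 =
     P $ i $ 2 + smult (a\<^sup>2 / 16) (hermite_raise (hermite_raise (pderiv (pderiv (P $ i $ 2)))))"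
    unfolding hermite_raise_raise
    by (rule poly_eqI_complex) (simp add: darboux_D_def mp_act_pCons mp_act_0 matrix_mult_nth sum_2
        mp_deriv_nth field_simps)
qed


section \<open>The action of V on coefficients and the preservation of degrees\<close>

lemma coeff_mp_act_V_1:
  "coeff (mp_act P (darboux_V a) $ i $ 1) k =
     coeff (P $ i $ 1) k - a / 4 * (of_nat (k + 1) * of_nat (k + 2)) * coeff (P $ i $ 2) (k + 2)"
  by (simp add: mp_act_V_nth coeff_pderiv)

text \<open>Only coefficients of index \<open>k\<close> and \<open>k + 2\<close> enter. Those of
  index \<open>k\<close> are transformed by a triangular matrix whose second pivot is 1 + a^2 k (k -
  1) / 4.\<close>

lemma coeff_mp_act_V_2:
  "coeff (mp_act P (darboux_V a) $ i $ 2) k =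
     a / 4 * (of_nat (k + 1) * of_nat (k + 2) * coeff (P $ i $ 1) (k + 2)
       - (4 * of_nat k + 2) * coeff (P $ i $ 1) k)
     + (1 + a\<^sup>2 / 4 * of_nat (k * (k - 1))) * coeff (P $ i $ 2) k"
proof -
  have "coeff ([:0, 4:] * pderiv p) k = 4 * of_nat k * coeff p k" for p :: "complex poly"
    by (cases k) (simp_all add: coeff_pderiv)
  moreover have "coeff ([:0, 0, c:] * pderiv (pderiv p)) k = c * of_nat (k * (k - 1)) * coeff p k"
    for p :: "complex poly" and c
    \<comment> \<open>The truncated \<open>k - 1\<close> is harmless, since the product with
      \<open>k\<close> is 0 at \<open>k = 0\<close>.\<close>
    by (cases k; cases "k - 1") (simp_all add: coeff_pderiv algebra_simps)
  ultimately show ?thesis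
    unfolding mp_act_V_nth coeff_add coeff_diff coeff_smult
    by (simp add: coeff_pderiv ring_distribs mult.assoc)
qed

text \<open>For real \<open>a\<close> the pivot is at least 1.\<close>

lemma darboux_V_pivot_nonzero: "1 + (complex_of_real a)\<^sup>2 / 4 * of_nat m \<noteq> 0"
proof -
  have "0 < 1 + a\<^sup>2 / 4 * real m"
    by (intro add_pos_nonneg mult_nonneg_nonneg) simp_all
  moreover have "1 + (complex_of_real a)\<^sup>2 / 4 * of_nat m = complex_of_real (1 + a\<^sup>2 / 4 * real m)"
    by simp
  ultimately show ?thesis by (metis less_irrefl of_real_eq_0_iff)
qed

text \<open>Where the coefficient of index \<open>k + 2\<close> vanishes, the one of index
  \<open>k\<close> is transformed by an invertible triangular matrix. This applies at and above the
  top degree of \<open>P\<close>.\<close>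

lemma degree_preserving_V: "degree_preserving (darboux_V (complex_of_real a))"
proof -
  let ?V = "darboux_V (complex_of_real a)"
  define vanish where "vanish P k \<longleftrightarrow> (\<forall>i j. coeff (P $ i $ j) k = 0)" for P :: "2 mpoly" and k
  have vanish_act: "vanish (mp_act P ?V) k \<longleftrightarrow> vanish P k" if "vanish P (k + 2)" for P k
    using that darboux_V_pivot_nonzero[of a "k * (k - 1)"]
    unfolding vanish_def forall_2 coeff_mp_act_V_1 coeff_mp_act_V_2 by auto
  have deg: "mp_degree P \<le> n \<longleftrightarrow> (\<forall>k>n. vanish P k)" for P :: "2 mpoly" and n
  proof -
    have "mp_degree P \<le> n \<longleftrightarrow> (\<forall>i j. degree (P $ i $ j) \<le> n)"
      unfolding mp_degree_def by (subst Max_le_iff) auto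
    also have "\<dots> \<longleftrightarrow> (\<forall>k>n. vanish P k)"
      unfolding vanish_def by (metis coeff_eq_0 degree_le order_le_less_trans)
    finally show ?thesis .
  qed
  \<comment> \<open>One equivalence serves both needs: \<open>n = 0\<close> settles when the image
    is zero, and \<open>Suc n\<close> settles degree bounds, regardless of the convention for the
    degree of 0.\<close>
  have vanish_ge: "(\<forall>k\<ge>n. vanish (mp_act P ?V) k) \<longleftrightarrow> (\<forall>k\<ge>n. vanish P k)" for P n
  proof
    assume "\<forall>k\<ge>n. vanish P k"
    then show "\<forall>k\<ge>n. vanish (mp_act P ?V) k" by (simp add: vanish_act)
  next
    assume act: "\<forall>k\<ge>n. vanish (mp_act P ?V) k"
    show "\<forall>k\<ge>n. vanish P k"
    proof (rule ccontr)
      assume "\<not> (\<forall>k\<ge>n. vanish P k)"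
      then obtain k where k: "n \<le> k" "\<not> vanish P k" by blast
      \<comment> \<open>At the last nonvanishing index \<open>m\<close> of \<open>P\<close>, index
        \<open>m + 2\<close> vanishes, so \<open>vanish_act\<close> carries the nonvanishing over to
        the image.\<close>
      define m where "m = (GREATEST m. \<not> vanish P m)"
      have bound: "\<not> vanish P m \<Longrightarrow> m \<le> mp_degree P" for m
        using deg[of P "mp_degree P"] by (meson not_le order_refl)
      have "\<not> vanish P m"
        unfolding m_def using k(2) bound by (rule GreatestI_nat)
      moreover have "k \<le> m"
        unfolding m_def using k(2) bound by (rule Greatest_le_nat)
      moreover have "vanish P (m + 2)"
        using Greatest_le_nat[of "\<lambda>k. \<not> vanish P k", OF _ bound] unfolding m_def by fastforce
      ultimately show False
        using act k(1) vanish_act[of P m] by simp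
    qed
  qed
  have zero: "P = 0 \<longleftrightarrow> (\<forall>k\<ge>0. vanish P k)" for P :: "2 mpoly"
    by (auto simp: vanish_def vec_eq_iff poly_eq_iff)
  have le: "mp_degree (mp_act P ?V) \<le> n \<longleftrightarrow> mp_degree P \<le> n" for P n
    using vanish_ge[of "Suc n" P] by (simp only: deg Suc_le_eq)
  have "mp_degree (mp_act P ?V) = mp_degree P" for P
    using le[of P "mp_degree P"] le[of P "mp_degree (mp_act P ?V)"] by (intro antisym) simp_all
  moreover have "mp_act P ?V = 0 \<longleftrightarrow> P = 0" for P
    using vanish_ge[of 0 P] by (simp only: zero)
  ultimately show ?thesis
    unfolding degree_preserving_def by blast
qed

text \<open>\<open>pCons\<close> drops a zero leading coefficient, so this is what gives
  \<open>darboux_V\<close> order 2. The determinant of this matrix is a^2 / 16.\<close>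

lemma darboux_V_lead_nonzero:
  fixes a :: complex
  assumes "a \<noteq> 0"
  shows "mat22 0 [:a / 4:] [:- a / 4:] [:0, 0, a\<^sup>2 / 4:] \<noteq> 0"
proof
  assume "mat22 0 [:a / 4:] [:- a / 4:] [:0, 0, a\<^sup>2 / 4:] = 0"
  from arg_cong[OF this, of "\<lambda>A. A $ 1 $ 2"] assms show False by simp
qed

lemma det_lead_coeff_V: "a \<noteq> 0 \<Longrightarrow> det (lead_coeff (darboux_V a)) \<noteq> 0"
  using darboux_V_lead_nonzero[of a] by (simp add: darboux_V_def det_2)

section \<open>Scalar form of the adjointness of V and N\<close>

lemma gauss_int_raise: "gauss_int (hermite_raise p * q) = gauss_int (p * pderiv q)"
  unfolding hermite_raise_def by (rule gauss_int_adjoint)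

text \<open>In the variable \<open>r = a x\<^sup>2 q\<^sub>1 + q\<^sub>2\<close>, the second component of \<open>q T\<close>, both sides only involve
  \<open>R\<^sup>2\<close> and \<open>\<partial>\<^sup>2\<close>, which are adjoint to each other.\<close>

lemma gauss_int_V_N:
  fixes p1 p2 q1 q2 :: "complex poly"
  shows "gauss_int ((p1 - smult (a / 4) (pderiv (pderiv p2)))
        * ([:1, 0, 0, 0, a\<^sup>2:] * q1 + [:0, 0, a:] * q2)
      + (smult (a / 4) (pderiv (pderiv p1) - [:0, 4:] * pderiv p1 - smult 2 p1)
          + p2 + [:0, 0, a\<^sup>2 / 4:] * pderiv (pderiv p2)) * ([:0, 0, a:] * q1 + q2))
   = gauss_int (p1 * (q1 + smult (a / 4) (pderiv (pderiv q2) + [:0, 0, a:] * pderiv (pderiv q1)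
          + [:0, 4 * a:] * pderiv q1 + smult (2 * a) q1))
      + p2 * (q2 - smult (a / 4) (pderiv (pderiv q1) - [:0, 4:] * pderiv q1 - smult 2 q1)))"
   (is "gauss_int ?l = gauss_int ?r")
proof -
  define r where "r = [:0, 0, a:] * q1 + q2"
  let ?R = "\<lambda>p. hermite_raise (hermite_raise p)"
  have r'': "pderiv (pderiv r) = pderiv (pderiv q2) + [:0, 0, a:] * pderiv (pderiv q1)
      + [:0, 4 * a:] * pderiv q1 + smult (2 * a) q1"
    by (rule poly_eqI_complex)
       (simp add: r_def pderiv_add pderiv_mult pderiv_pCons pderiv_smult algebra_simps)
  \<comment> \<open>The first row of the weight paired with q is q1 + a x^2 r. Its a x^2 p1 r
    completes (a/4) R^2 p1 r, and its p2'' r term cancels the one from the second component.\<close>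
  have l: "?l = (p1 * q1 + p2 * r) - smult (a / 4) (q1 * pderiv (pderiv p2)) + smult (a / 4) (?R p1 * r)"
    by (rule poly_eqI_complex)
       (simp add: r_def hermite_raise_raise field_simps power2_eq_square)
  have r: "?r = (p1 * q1 + p2 * r) + smult (a / 4) (p1 * pderiv (pderiv r)) - smult (a / 4) (?R q1 * p2)"
    unfolding r'' by (rule poly_eqI_complex)
       (simp add: r_def hermite_raise_raise field_simps power2_eq_square)
  have "gauss_int (?R p * q) = gauss_int (p * pderiv (pderiv q))" for p q
    by (simp only: gauss_int_raise)
  then show ?thesis
    unfolding l r gauss_int_add gauss_int_diff gauss_int_smult by simp
qed

section \<open>The factorization D = V N on smooth functions\<close>

lemma mp_deriv_mat22: "mp_deriv (mat22 p q r s) = mat22 (pderiv p) (pderiv q) (pderiv r) (pderiv s)"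
  by (rule mat22_eqI) (simp_all add: mp_deriv_nth)

lemma mat22_mult:
  "mat22 p q r s ** mat22 p' q' r' s' =
     mat22 (p * p' + q * r') (p * q' + q * s') (r * p' + s * r') (r * q' + s * (s' :: 'a::semiring_1))"
  by (rule mat22_eqI) (simp_all add: matrix_mult_nth sum_2)

lemma mat22_add:
  "mat22 p q r s + mat22 p' q' r' s' = mat22 (p + p') (q + q') (r + r') (s + (s' :: 'a::monoid_add))"
  by (rule mat22_eqI) simp_all

lemma mat22_diff:
  "mat22 p q r s - mat22 p' q' r' s' = mat22 (p - p') (q - q') (r - r') (s - (s' :: 'a::group_add))"
  by (rule mat22_eqI) simp_all

lemma mp_herm_mat22:
  "mp_herm (mat22 p q r s) = mat22 (map_poly cnj p) (map_poly cnj r) (map_poly cnj q) (map_poly cnj s)"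
  by (rule mat22_eqI) (simp_all add: mp_herm_nth)

lemma mfun_act_mdop3:
  "mfun_act f (mdop_funs [:A, B, C:]) x =
     f x ** mp_eval A x + mfun_deriv f x ** mp_eval B x + mfun_deriv (mfun_deriv f) x ** mp_eval C x"
  by (simp add: mfun_act_mdop_funs_pCons mfun_act_mdop_funs_0 add.assoc)

lemma is_dop_product_VN:
  "is_dop_product (- \<infinity>) \<infinity> (mdop_funs (darboux_D a)) (mdop_funs (darboux_V a)) (mdop_funs (darboux_N a))"
proof -
  have "mfun_act f (mdop_funs (darboux_D a)) x
      = mfun_act (mfun_act f (mdop_funs (darboux_V a))) (mdop_funs (darboux_N a)) x"
    if f0: "mfun_smooth_on f UNIV" for f x
  proof -
    \<comment> \<open>The coefficients are kept as opaque names, so that explicit matrices appear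
      only in the check of \<open>D\<close>.\<close>
    obtain V0 V1 V2 where V: "darboux_V a = [:V0, V1, V2:]"
      "V0 = mat22 1 [:- a / 2:] 0 1" "V1 = mat22 0 [:0, - a:] 0 0"
      "V2 = mat22 0 [:a / 4:] [:- a / 4:] [:0, 0, a\<^sup>2 / 4:]"
      by (simp add: darboux_V_def)
    obtain N0 N1 N2 where N: "darboux_N a = [:N0, N1, N2:]"
      "N0 = mat22 [:1 + a\<^sup>2 / 2:] [:a / 2:] 0 1" "N1 = mat22 [:0, a\<^sup>2:] [:0, a:] 0 0"
      "N2 = mat22 [:0, 0, a\<^sup>2 / 4:] [:- a / 4:] [:a / 4:] 0"
      by (simp add: darboux_N_def)
    define V0' V1' V2' where V': "V0' = mp_deriv V0" "V1' = mp_deriv V1" "V2' = mp_deriv V2"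
    define V0'' V1'' V2'' where V'': "V0'' = mp_deriv V0'" "V1'' = mp_deriv V1'" "V2'' = mp_deriv V2'"
    \<comment> \<open>Leibniz coefficients of the composition, collected by the order of the
      derivative of \<open>f\<close>. Repeated summands stand for the binomial factor 2, so the
      comparison below needs only distributivity and reordering.\<close>
    have D: "darboux_D a = [:V0 ** N0 + V0' ** N1 + V0'' ** N2,
        V1 ** N0 + V0 ** N1 + V1' ** N1 + V0' ** N2 + V0' ** N2 + V1'' ** N2,
        V2 ** N0 + V1 ** N1 + V2' ** N1 + V0 ** N2 + V1' ** N2 + V1' ** N2 + V2'' ** N2,
        V2 ** N1 + V1 ** N2 + V2' ** N2 + V2' ** N2,
        V2 ** N2:]"
      unfolding V(2-4) V' V'' N(2-4) mp_deriv_mat22 mat22_mult mat22_add darboux_D_def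
      by (simp add: pderiv_pCons one_pCons power2_eq_square) (simp add: field_simps)
    define f1 f2 f3 f4 where fs: "f1 = mfun_deriv f" "f2 = mfun_deriv f1" "f3 = mfun_deriv f2"
      "f4 = mfun_deriv f3"
    have f1: "mfun_smooth_on f1 UNIV" and f2: "mfun_smooth_on f2 UNIV" and f3: "mfun_smooth_on f3 UNIV"
      using f0 by (simp_all add: fs smooth_mfun_deriv)
    note der = f0[THEN smooth_has_vector_derivative, folded fs]
      f1[THEN smooth_has_vector_derivative, folded fs]
      f2[THEN smooth_has_vector_derivative, folded fs] f3[THEN smooth_has_vector_derivative, folded fs]
    note rules = has_vector_derivative_add has_vector_derivative_matrix_mult has_vector_derivative_mp_eval der
    define h where "h = mfun_act f (mdop_funs (darboux_V a))"
    have h: "h = (\<lambda>x. f x ** mp_eval V0 x + f1 x ** mp_eval V1 x + f2 x ** mp_eval V2 x)"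
      by (simp add: h_def V(1) mfun_act_mdop3 fs fun_eq_iff)
    have h1: "mfun_deriv h = (\<lambda>x. (f1 x ** mp_eval V0 x + f x ** mp_eval V0' x)
        + (f2 x ** mp_eval V1 x + f1 x ** mp_eval V1' x) + (f3 x ** mp_eval V2 x + f2 x ** mp_eval V2' x))"
      unfolding h V' by (intro mfun_derivI rules)
    have h2: "mfun_deriv (mfun_deriv h) = (\<lambda>x.
          ((f2 x ** mp_eval V0 x + f1 x ** mp_eval V0' x) + (f1 x ** mp_eval V0' x + f x ** mp_eval V0'' x))
        + ((f3 x ** mp_eval V1 x + f2 x ** mp_eval V1' x) + (f2 x ** mp_eval V1' x + f1 x ** mp_eval V1'' x))
        + ((f4 x ** mp_eval V2 x + f3 x ** mp_eval V2' x) + (f3 x ** mp_eval V2' x + f2 x ** mp_eval V2'' x)))"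
      unfolding h1 unfolding V'' unfolding V' by (intro mfun_derivI rules)
    have "mfun_act h (mdop_funs (darboux_N a)) x
        = h x ** mp_eval N0 x + mfun_deriv h x ** mp_eval N1 x + mfun_deriv (mfun_deriv h) x ** mp_eval N2 x"
      by (simp only: N(1) mfun_act_mdop3)
    also have "\<dots> = mfun_act f (mdop_funs (darboux_D a)) x"
      unfolding D mfun_act_mdop_funs_pCons mfun_act_mdop_funs_0 fs[symmetric]
      unfolding h2 unfolding h1 unfolding h
      by (simp only: mp_eval_add mp_eval_mult matrix_mult_distribs matrix_mul_assoc add_ac add_0_left add_0_right)
    finally have "mfun_act h (mdop_funs (darboux_N a)) x = mfun_act f (mdop_funs (darboux_D a)) x" .
    then show ?thesis by (simp add: h_def)
  qed
  then show ?thesis by (simp add: is_dop_product_def einterval_UNIV)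
qed

section \<open>Gaussian matrix functions and the adjoint of \<open>V\<close>\<close>

definition gauss_mfun :: "('n::finite) mpoly \<Rightarrow> 'n mfun" where
  "gauss_mfun R x = exp (- x\<^sup>2) *\<^sub>R mp_eval R x"

text \<open>The polynomial factor of the derivative of e^(-x^2) R. Gaussian matrix functions are
  thus closed under differentiation.\<close>

definition gauss_deriv :: "('n::finite) mpoly \<Rightarrow> 'n mpoly" where
  "gauss_deriv R = (\<chi> i j. pderiv (R $ i $ j) - [:0, 2:] * R $ i $ j)"

lemma gauss_deriv_mat22:
  "gauss_deriv (mat22 p q r s) = mat22 (pderiv p - [:0, 2:] * p) (pderiv q - [:0, 2:] * q)
     (pderiv r - [:0, 2:] * r) (pderiv s - [:0, 2:] * s)"
  by (rule mat22_eqI) (simp_all add: gauss_deriv_def)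

lemma has_vector_derivative_gauss_mfun:
  "(gauss_mfun R has_vector_derivative gauss_mfun (gauss_deriv R) x) (at x)"
proof -
  have "((\<lambda>x::real. exp (- x\<^sup>2)) has_real_derivative - 2 * x * exp (- x\<^sup>2)) (at x)"
    by (auto intro!: derivative_eq_intros)
  from has_vector_derivative_scaleR[OF this has_vector_derivative_mp_eval]
  have "((\<lambda>x. exp (- x\<^sup>2) *\<^sub>R mp_eval R x) has_vector_derivative
      exp (- x\<^sup>2) *\<^sub>R mp_eval (mp_deriv R) x + (- 2 * x * exp (- x\<^sup>2)) *\<^sub>R mp_eval R x) (at x)" .
  moreover have "mp_eval (gauss_deriv R) x = mp_eval (mp_deriv R) x - (2 * x) *\<^sub>R mp_eval R x"
    by (simp add: vec_eq_iff mp_eval_nth mp_deriv_nth gauss_deriv_def scaleR_conv_of_real[where 'a = complex])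
  then have "exp (- x\<^sup>2) *\<^sub>R mp_eval (mp_deriv R) x + (- 2 * x * exp (- x\<^sup>2)) *\<^sub>R mp_eval R x
      = gauss_mfun (gauss_deriv R) x"
    by (simp add: gauss_mfun_def scaleR_diff_right mult_ac)
  ultimately show ?thesis
    by (simp add: gauss_mfun_def[abs_def])
qed

lemma times_differentiable_gauss_mfun: "mfun_times_differentiable_on k (gauss_mfun R) UNIV"
proof (induction k arbitrary: R)
  case (Suc k)
  show ?case
    by (rule times_differentiable_SucI[OF has_vector_derivative_gauss_mfun Suc.IH])
qed (rule times_differentiable_0)

section \<open>The two weights: polynomial factors, inverse and positivity\<close>

lemma herm_nth: "herm A $ i $ j = cnj (A $ j $ i)"
  by (simp add: herm_def)

lemma hermite_weight_eq: "hermite_weight x = gauss_mfun (mat 1) x"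
proof -
  have "mp_eval (mat 1 :: 2 mpoly) x = mat 1"
    by (rule mat22_eqI) (simp_all add: mp_eval_nth mat_def)
  then show ?thesis by (simp add: hermite_weight_def gauss_mfun_def)
qed

lemma example_weight_eq: "example_weight a x = gauss_mfun (weight_poly (complex_of_real a)) x"
proof -
  have "mat22 (complex_of_real (1 + a\<^sup>2 * x ^ 4)) (of_real (a * x\<^sup>2)) (of_real (a * x\<^sup>2)) 1
      = mp_eval (weight_poly (complex_of_real a)) x"
    by (rule mat22_eqI) (simp_all add: weight_poly_def mp_eval_nth power2_eq_square power4_eq_xxxx)
  then show ?thesis
    unfolding example_weight_def gauss_mfun_def mat22_def by simp
qed

lemma matrix_inv_hermite_weight: "matrix_inv (hermite_weight x) = exp (x\<^sup>2) *\<^sub>R mat 1"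
proof -
  let ?W = "hermite_weight x" and ?B = "exp (x\<^sup>2) *\<^sub>R mat 1 :: complex^2^2"
  have inv: "?W ** ?B = mat 1" "?B ** ?W = mat 1"
    by (simp_all add: hermite_weight_def matrix_mult_distribs flip: exp_add)
  show ?thesis
    unfolding matrix_inv_def
  proof (rule some_equality)
    \<comment> \<open>\<open>matrix_inv\<close> is defined by choice, so the inverse is identified
      by uniqueness.\<close>
    show "A = ?B" if "?W ** A = mat 1 \<and> A ** ?W = mat 1" for A
      using that inv by (metis matrix_mul_assoc matrix_mul_lid matrix_mul_rid)
  qed (use inv in blast)
qed

lemma pos_def_2I:
  fixes A :: "complex^2^2"
  assumes "herm A = A"
    and "\<And>u v. u \<noteq> 0 \<or> v \<noteq> 0 \<Longrightarrow>
      Re (cnj u * A $ 1 $ 1 * u + cnj u * A $ 1 $ 2 * v + cnj v * A $ 2 $ 1 * u + cnj v * A $ 2 $ 2 * v) > 0"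
  shows "pos_def A"
  unfolding pos_def_def
proof (intro conjI assms(1) allI impI)
  fix v :: "complex^2"
  assume "v \<noteq> 0"
  then have "v $ 1 \<noteq> 0 \<or> v $ 2 \<noteq> 0" by (simp add: vec_eq_iff forall_2)
  from assms(2)[OF this] show "Re (\<Sum>i\<in>UNIV. \<Sum>j\<in>UNIV. cnj (v $ i) * A $ i $ j * v $ j) > 0"
    by (simp add: sum_2 algebra_simps)
qed

text \<open>The quadratic form of the weight is \<open>exp (- x\<^sup>2)\<close> times
  \<open>\<bar>u\<bar>\<^sup>2 + \<bar>v + a x\<^sup>2 u\<bar>\<^sup>2\<close>.\<close>

lemma pos_def_example_weight: "pos_def (example_weight a x)"
proof (rule pos_def_2I)
  show "herm (example_weight a x) = example_weight a x"
    by (rule mat22_eqI) (simp_all add: herm_nth example_weight_def vector_2)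
  fix u v :: complex
  assume uv: "u \<noteq> 0 \<or> v \<noteq> 0"
  define c where "c = a * x\<^sup>2"
  have c2: "a\<^sup>2 * x ^ 4 = c\<^sup>2" by (simp add: c_def power_mult_distrib flip: power_mult)
  let ?w = "v + of_real c * u"
  have "0 < (cmod u)\<^sup>2 + (cmod ?w)\<^sup>2"
    using uv by (auto simp: sum_power2_gt_zero_iff)
  then have "0 < exp (- x\<^sup>2) * ((cmod u)\<^sup>2 + (cmod ?w)\<^sup>2)" by simp
  also have "\<dots> = Re (cnj u * example_weight a x $ 1 $ 1 * u + cnj u * example_weight a x $ 1 $ 2 * v
      + cnj v * example_weight a x $ 2 $ 1 * u + cnj v * example_weight a x $ 2 $ 2 * v)"
    unfolding example_weight_def c2 c_def[symmetric]
    by (simp only: cmod_power2) (simp add: vector_2 algebra_simps power2_eq_square)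
  finally show "0 < \<dots>" .
qed

lemma pos_def_hermite_weight: "pos_def (hermite_weight x)"
proof -
  \<comment> \<open>Positivity is inherited from the case \<open>a = 0\<close> of the other
    weight.\<close>
  have "example_weight 0 x = hermite_weight x"
    unfolding example_weight_def hermite_weight_def
    by (rule mat22_eqI) (simp_all add: vector_2 mat_def)
  then show ?thesis by (metis pos_def_example_weight)
qed

lemma weight_mult_herm:
  "A ** example_weight a x ** herm (mp_eval C x)
     = A ** gauss_mfun (weight_poly (complex_of_real a) ** mp_herm C) x"
  by (simp add: example_weight_eq herm_mp_eval gauss_mfun_def mp_eval_mult matrix_mult_distribs
      matrix_mul_assoc)

text \<open>Each product W F_j^* is e^(-x^2) times a polynomial matrix \<open>R j\<close>.
  Differentiation preserves this form, and the inverse Hermite weight removes the Gaussian, leaving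
  polynomial coefficients.\<close>

lemma is_darboux_adjoint_VN:
  assumes "a \<noteq> 0"
  shows "is_darboux_adjoint (- \<infinity>) \<infinity> hermite_weight (example_weight a)
    (darboux_V (complex_of_real a)) (mdop_funs (darboux_N (complex_of_real a)))"
proof -
  let ?a = "complex_of_real a"
  define V where "V = darboux_V ?a"
  define R where "R k = weight_poly ?a ** mp_herm (coeff V k)" for k
  have deg: "degree V = 2"
    using darboux_V_lead_nonzero[of ?a] assms by (simp add: V_def darboux_V_def)
  have coeffs: "coeff V 0 = mat22 1 [:- ?a / 2:] 0 1" "coeff V 1 = mat22 0 [:0, - ?a:] 0 0"
    "coeff V 2 = mat22 0 [:?a / 4:] [:- ?a / 4:] [:0, 0, ?a\<^sup>2 / 4:]"
    by (simp_all add: V_def darboux_V_def numeral_2_eq_2)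
  have herms: "mp_herm (coeff V 0) = mat22 1 0 [:- ?a / 2:] 1"
    "mp_herm (coeff V 1) = mat22 0 0 [:0, - ?a:] 0"
    "mp_herm (coeff V 2) = mat22 0 [:- ?a / 4:] [:?a / 4:] [:0, 0, ?a\<^sup>2 / 4:]"
    unfolding coeffs mp_herm_mat22 by (simp_all add: map_poly_pCons one_pCons)
  define R1' R2' R2'' where R': "R1' = gauss_deriv (R 1)" "R2' = gauss_deriv (R 2)" "R2'' = gauss_deriv R2'"
  \<comment> \<open>Leibniz expansion of f R_0 - (f R_1)' + (f R_2)'', with
    \<open>gauss_deriv\<close> as the derivative of each R_j.\<close>
  have N: "darboux_N ?a = [:R 0 - R1' + R2'', R2' + R2' - R 1, R 2:]"
    unfolding darboux_N_def R' R_def herms weight_poly_def mat22_mult gauss_deriv_mat22 mat22_add mat22_diff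
    by (simp add: pderiv_pCons one_pCons power2_eq_square)
  have adj: "(\<forall>j\<le>degree V. mfun_times_differentiable_on j
            (\<lambda>y. f y ** example_weight a y ** herm (mp_eval (coeff V j) y)) UNIV) \<and>
        (\<forall>x. mfun_act f (mdop_funs (darboux_N ?a)) x =
              mfun_act_adjoint (\<lambda>y. f y ** example_weight a y) V x ** matrix_inv (hermite_weight x))"
    if f0: "mfun_smooth_on f UNIV" for f
  proof (intro conjI allI impI)
    show "mfun_times_differentiable_on j
            (\<lambda>y. f y ** example_weight a y ** herm (mp_eval (coeff V j) y)) UNIV" for j
      unfolding weight_mult_herm
      using f0 by (intro times_differentiable_mult times_differentiable_gauss_mfun)
        (simp add: mfun_smooth_on_def)
  next
    fix x
    define f1 f2 where fs: "f1 = mfun_deriv f" "f2 = mfun_deriv f1"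
    have f1: "mfun_smooth_on f1 UNIV"
      using f0 by (simp add: fs smooth_mfun_deriv)
    note der = f0[THEN smooth_has_vector_derivative, folded fs]
      f1[THEN smooth_has_vector_derivative, folded fs]
    note rules = has_vector_derivative_add has_vector_derivative_matrix_mult
      has_vector_derivative_gauss_mfun der
    have d1: "mfun_deriv (\<lambda>y. f y ** gauss_mfun S y)
        = (\<lambda>y. f1 y ** gauss_mfun S y + f y ** gauss_mfun (gauss_deriv S) y)" for S
      by (intro mfun_derivI rules)
    have d2: "mfun_deriv (mfun_deriv (\<lambda>y. f y ** gauss_mfun S y))
        = (\<lambda>y. (f2 y ** gauss_mfun S y + f1 y ** gauss_mfun (gauss_deriv S) y)
            + (f1 y ** gauss_mfun (gauss_deriv S) y + f y ** gauss_mfun (gauss_deriv (gauss_deriv S)) y))" for S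
      unfolding d1 by (intro mfun_derivI rules)
    have "mfun_act_adjoint (\<lambda>y. f y ** example_weight a y) V x
        = f x ** gauss_mfun (R 0) x
          - (f1 x ** gauss_mfun (R 1) x + f x ** gauss_mfun R1' x)
          + ((f2 x ** gauss_mfun (R 2) x + f1 x ** gauss_mfun R2' x)
             + (f1 x ** gauss_mfun R2' x + f x ** gauss_mfun R2'' x))"
    proof -
      have *: "{..2::nat} = {0, 1, 2}" by auto
      have **: "(mfun_deriv ^^ 2) h = mfun_deriv (mfun_deriv h)" for h :: "2 mfun"
        by (simp add: numeral_2_eq_2)
      show ?thesis
        unfolding mfun_act_adjoint_def deg * weight_mult_herm R_def[symmetric]
        by (simp add: ** d1 d2[unfolded d1] R')
    qed
    moreover have "gauss_mfun S x ** (exp (x\<^sup>2) *\<^sub>R mat 1) = mp_eval S x" for S :: "2 mpoly"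
      by (simp add: gauss_mfun_def matrix_mult_distribs flip: exp_add)
    ultimately have "mfun_act_adjoint (\<lambda>y. f y ** example_weight a y) V x ** matrix_inv (hermite_weight x)
        = f x ** mp_eval (R 0) x
          - (f1 x ** mp_eval (R 1) x + f x ** mp_eval R1' x)
          + ((f2 x ** mp_eval (R 2) x + f1 x ** mp_eval R2' x)
             + (f1 x ** mp_eval R2' x + f x ** mp_eval R2'' x))"
      by (simp only: matrix_inv_hermite_weight matrix_mult_distribs(1,3) matrix_mul_assoc[symmetric])
    also have "\<dots> = mfun_act f (mdop_funs (darboux_N ?a)) x"
      unfolding N mfun_act_mdop3 fs[symmetric] mp_eval_add mp_eval_diff matrix_mult_distribs by simp
    finally show "mfun_act f (mdop_funs (darboux_N ?a)) x =
              mfun_act_adjoint (\<lambda>y. f y ** example_weight a y) V x ** matrix_inv (hermite_weight x)" ..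
  qed
  moreover have "\<forall>G\<in>set (mdop_funs (darboux_N ?a)). mfun_smooth_on G UNIV"
    by (auto simp: mdop_funs_def smooth_mp_eval)
  ultimately show ?thesis
    unfolding is_darboux_adjoint_def einterval_UNIV V_def[symmetric] by blast
qed

section \<open>The adjoint identity for the matrix inner products\<close>

lemma map_poly_cnj_hom:
  "map_poly cnj (p + q) = map_poly cnj p + map_poly cnj q"
  "map_poly cnj (p - q) = map_poly cnj p - map_poly cnj q"
  "map_poly cnj (p * q) = map_poly cnj p * map_poly cnj q"
  "map_poly cnj (smult c p) = smult (cnj c) (map_poly cnj p)"
  "map_poly cnj (pderiv p) = pderiv (map_poly cnj p)"
  by (simp_all add: poly_eq_iff coeff_map_poly coeff_mult coeff_pderiv)

text \<open>Entry (i, j) is \<open>gauss_int_V_N\<close> for row \<open>i\<close> of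
  \<open>P\<close> and the conjugated row \<open>j\<close> of \<open>Q\<close>.\<close>

lemma mfun_ip_example_weight:
  "mfun_ip (- \<infinity>) \<infinity> (example_weight a) (mp_eval (mp_act P (darboux_V (complex_of_real a)))) (mp_eval Q)
   = mfun_ip (- \<infinity>) \<infinity> hermite_weight (mp_eval P)
       (mfun_act (mp_eval Q) (mdop_funs (darboux_N (complex_of_real a))))"
proof -
  let ?a = "complex_of_real a"
  have l: "mp_eval (mp_act P (darboux_V ?a)) x ** example_weight a x ** herm (mp_eval Q x)
      = exp (- x\<^sup>2) *\<^sub>R mp_eval (mp_act P (darboux_V ?a) ** (weight_poly ?a ** mp_herm Q)) x" for x
    by (simp only: weight_mult_herm gauss_mfun_def mp_eval_mult matrix_mult_distribs)
  have r: "mp_eval P x ** hermite_weight x ** herm (mfun_act (mp_eval Q) (mdop_funs (darboux_N ?a)) x)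
      = exp (- x\<^sup>2) *\<^sub>R mp_eval (P ** mp_herm (mp_act Q (darboux_N ?a))) x" for x
    by (simp add: hermite_weight_def mfun_act_mp_eval herm_mp_eval mp_eval_mult matrix_mult_distribs)
  \<comment> \<open>Since \<open>a\<close> is real, conjugating the image of \<open>Q\<close> under
    N amounts to applying N to the conjugated entries.\<close>
  have herm_N: "mp_herm (mp_act Q (darboux_N ?a)) $ 1 $ j = map_poly cnj (Q $ j $ 1)
      + smult (?a / 4) (pderiv (pderiv (map_poly cnj (Q $ j $ 2)))
        + [:0, 0, ?a:] * pderiv (pderiv (map_poly cnj (Q $ j $ 1)))
        + [:0, 4 * ?a:] * pderiv (map_poly cnj (Q $ j $ 1)) + smult (2 * ?a) (map_poly cnj (Q $ j $ 1)))"
    "mp_herm (mp_act Q (darboux_N ?a)) $ 2 $ j = map_poly cnj (Q $ j $ 2)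
      - smult (?a / 4) (pderiv (pderiv (map_poly cnj (Q $ j $ 1)))
        - [:0, 4:] * pderiv (map_poly cnj (Q $ j $ 1)) - smult 2 (map_poly cnj (Q $ j $ 1)))" for j
    unfolding mp_herm_nth mp_act_N_nth map_poly_cnj_hom by (simp_all add: map_poly_pCons)
  have "gauss_int ((mp_act P (darboux_V ?a) ** (weight_poly ?a ** mp_herm Q)) $ i $ j)
      = gauss_int ((P ** mp_herm (mp_act Q (darboux_N ?a))) $ i $ j)" for i j
    using gauss_int_V_N[where a = ?a and ?p1.0 = "P $ i $ 1" and ?p2.0 = "P $ i $ 2"
        and ?q1.0 = "map_poly cnj (Q $ j $ 1)" and ?q2.0 = "map_poly cnj (Q $ j $ 2)"]
    unfolding matrix_mult_nth sum_2 mp_act_V_nth herm_N weight_poly_def mat22_nth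
    unfolding mp_herm_nth mult_1_left .
  then show ?thesis
    by (simp only: vec_eq_iff mfun_ip_gauss[of _ _ _ "_ ** (_ ** _)", OF l] mfun_ip_gauss[OF r] simp_thms)
qed

section \<open>Hermite polynomials as eigenfunctions of \<open>D\<close>\<close>

definition hermite_mpoly :: "nat \<Rightarrow> 2 mpoly" where
  "hermite_mpoly n = mat22 (hermite n) 0 0 (hermite n)"

lemma monic_orthogonal_hermite: "monic_orthogonal_polys (- \<infinity>) \<infinity> hermite_weight hermite_mpoly"
  unfolding monic_orthogonal_polys_def
proof (intro conjI allI impI)
  fix n
  have "range (\<lambda>(i, j). degree (hermite_mpoly n $ i $ j)) = {0, n}"
    unfolding UNIV_Times_UNIV[symmetric] UNIV_2 by (auto simp: hermite_mpoly_def degree_hermite image_iff)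
  then show "mp_degree (hermite_mpoly n) = n" by (simp add: mp_degree_def)
  show "mp_coeff (hermite_mpoly n) n = mat 1"
    by (rule mat22_eqI) (simp_all add: mp_coeff_def hermite_mpoly_def mat_def coeff_hermite)
next
  fix n m :: nat
  assume "n \<noteq> m"
  have "mp_eval (hermite_mpoly n) x ** hermite_weight x ** herm (mp_eval (hermite_mpoly m) x)
      = exp (- x\<^sup>2) *\<^sub>R mp_eval (mat22 (hermite n * hermite m) 0 0 (hermite n * hermite m)) x" for x
    unfolding hermite_mpoly_def hermite_weight_def herm_mp_eval mp_herm_mat22 cnj_hermite
    by (simp add: matrix_mult_distribs mat22_mult flip: mp_eval_mult)
  from mfun_ip_gauss[of _ _ _ "mat22 _ _ _ _", OF this]
  show "mfun_ip (- \<infinity>) \<infinity> hermite_weight (mp_eval (hermite_mpoly n)) (mp_eval (hermite_mpoly m)) = 0"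
    by (intro mat22_eqI) (simp_all add: gauss_int_0 gauss_int_hermite[OF \<open>n \<noteq> m\<close>])
qed

text \<open>By the ladder relations, \<partial>^2 after R^2 multiplies \<open>hermite n\<close> by 4
  (n + 1) (n + 2), and R^2 after \<partial>^2 multiplies it by 4 n (n - 1).\<close>

lemma darboux_D_bispectral: "darboux_D a \<in> bispectral_algebra (- \<infinity>) \<infinity> hermite_weight"
proof -
  have zero: "hermite_raise 0 = 0" by (simp add: hermite_raise_def)
  have up: "pderiv (pderiv (hermite_raise (hermite_raise (hermite n))))
      = smult (4 * of_nat (n + 2) * of_nat (n + 1)) (hermite n)" for n
    by (simp add: hermite_raise_hermite hermite_raise_smult pderiv_smult pderiv_hermite
        del: hermite.simps of_nat_Suc)
  \<comment> \<open>For n < 2 the second derivative vanishes and the factor is 0, so only larger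
    \<open>n\<close> use the ladder.\<close>
  have down: "\<exists>c. hermite_raise (hermite_raise (pderiv (pderiv (hermite n)))) = smult c (hermite n)" for n
  proof (cases n)
    case 0
    then show ?thesis by (auto intro!: exI[of _ 0] simp: zero)
  next
    case (Suc k)
    show ?thesis
    proof (cases k)
      case 0
      then show ?thesis by (auto intro!: exI[of _ 0] simp: Suc zero pderiv_hermite pderiv_smult simp del: hermite.simps(2))
    next
      case (Suc l)
      then have "n = Suc (Suc l)" using \<open>n = Suc k\<close> by simp
      then show ?thesis
        by (auto simp: hermite_raise_hermite hermite_raise_smult pderiv_smult pderiv_hermite
            simp del: hermite.simps)
    qed
  qed
  have "\<exists>\<Lambda>. mp_act (hermite_mpoly n) (darboux_D a) = mp_const \<Lambda> ** hermite_mpoly n" for n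
  proof -
    obtain c where c: "hermite_raise (hermite_raise (pderiv (pderiv (hermite n)))) = smult c (hermite n)"
      using down by blast
    show ?thesis
      by (rule exI[of _ "mat22 (1 + a\<^sup>2 / 16 * (4 * of_nat (n + 2) * of_nat (n + 1)))
            0 0 (1 + a\<^sup>2 / 16 * c)"],
          rule mat22_eqI)
        (simp_all only: mp_act_D_nth hermite_mpoly_def mat22_nth up c,
         simp_all add: matrix_mult_nth sum_2 mp_const_def smult_add_left zero)
  qed
  then show ?thesis
    unfolding bispectral_algebra_def using monic_orthogonal_hermite by blast
qed

theorem proposition5p3:
  fixes a :: real
  assumes "a \<noteq> 0"
  shows "strong_darboux_transformation (- \<infinity>) \<infinity> hermite_weight (example_weight a)"
proof -
  let ?a = "complex_of_real a"
  have "weight_matrix (- \<infinity>) \<infinity> hermite_weight" "weight_matrix (- \<infinity>) \<infinity> (example_weight a)"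
    by (rule weight_matrix_gauss;
        simp add: hermite_weight_eq example_weight_eq gauss_mfun_def
          pos_def_hermite_weight[unfolded hermite_weight_eq gauss_mfun_def]
          pos_def_example_weight[unfolded example_weight_eq gauss_mfun_def])+
  moreover have "det (lead_coeff (darboux_V ?a)) \<noteq> 0"
    using assms by (intro det_lead_coeff_V) simp
  ultimately show ?thesis
    unfolding strong_darboux_transformation_def
    using degree_preserving_V is_darboux_adjoint_VN[OF assms] is_dop_product_VN
      darboux_D_bispectral mfun_ip_example_weight by blast
qed

end
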